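(* Let $G$ be a graph with $n$ vertices and $m$ edges, and let $k\ge 1$ be an integer. Then the supertoken graph $F_k^k(G)$ has size $$|E(F_k^k(G))|=m\binom{n+k-2}{k-1}.$$
   Context: Graphs are finite, simple and undirected. For a graph $G=(V,E)$ and an integer $k\ge 1$, the supertoken graph $F_k^k(G)$ has as vertices all multisets of $k$ elements of $V$ (distributions of $k$ identical tokens on the vertices of $G$, with any number of tokens, up to $k$, allowed on a vertex). Two such multisets are adjacent if one is obtained from the other by replacing one occurrence of a vertex $u$ by a vertex $v$ with $uv\in E$ (moving one token along an edge of $G$). The size of a graph is its number of edges. *)

theory Defs
  imports "HOL-Library.Multiset"
begin

record 'a graph =
  verts :: "'a set"
  edges :: "'a set set"

definition simple_graph :: "'a graph \<Rightarrow> bool" where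
  "simple_graph G \<longleftrightarrow>
     finite (verts G) \<and> (\<forall>e \<in> edges G. e \<subseteq> verts G \<and> card e = 2)"

definition token_move :: "'a graph \<Rightarrow> 'a multiset \<Rightarrow> 'a multiset \<Rightarrow> bool" where
  "token_move G A B \<longleftrightarrow>
     (\<exists>u v. {u, v} \<in> edges G \<and> u \<in># A \<and> B = add_mset v (A - {#u#}))"

definition supertoken_graph :: "nat \<Rightarrow> 'a graph \<Rightarrow> 'a multiset graph" where
  "supertoken_graph k G =
     (let W = {A. size A = k \<and> set_mset A \<subseteq> verts G}
      in \<lparr> verts = W, edges = {{A, B} | A B. A \<in> W \<and> B \<in> W \<and> token_move G A B} \<rparr>)"

lemma token_move_neq:
  assumes "simple_graph G" "token_move G A B"
  shows "A \<noteq> B"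
proof
  assume "A = B"
  from assms(2) obtain u v where uv: "{u, v} \<in> edges G" "u \<in># A"
    "B = add_mset v (A - {#u#})" unfolding token_move_def by blast
  then have "add_mset u (A - {#u#}) = add_mset v (A - {#u#})"
    using \<open>A = B\<close> insert_DiffM[of u A] by metis
  then have "u = v" by simp
  then show False using assms(1) uv(1) by (auto simp: simple_graph_def)
qed

lemma simple_graph_supertoken:
  assumes "simple_graph G"
  shows "simple_graph (supertoken_graph k G)"
proof -
  have "{A. size A = k \<and> set_mset A \<subseteq> verts G} \<subseteq> mset ` {xs. set xs \<subseteq> verts G \<and> length xs = k}"
  proof
    fix A assume A: "A \<in> {A. size A = k \<and> set_mset A \<subseteq> verts G}"
    obtain xs where "mset xs = A" using ex_mset by blast
    with A show "A \<in> mset ` {xs. set xs \<subseteq> verts G \<and> length xs = k}" by auto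
  qed
  moreover have "finite (verts G)" using assms by (simp add: simple_graph_def)
  ultimately have "finite {A. size A = k \<and> set_mset A \<subseteq> verts G}"
    by (rule finite_subset[OF _ finite_imageI[OF finite_lists_length_eq]])
  moreover have "card {A, B} = 2" if "token_move G A B" for A B
    using token_move_neq[OF assms that] by simp
  ultimately show ?thesis
    unfolding simple_graph_def supertoken_graph_def Let_def by auto
qed

end

(* An edge of the supertoken graph is determined by the edge of G along which the token moves and the
   multiset of the k - 1 tokens that stay in place, which is the intersection of the two endpoints. *)
theory Submission
  imports Defs
begin

lemma add_mset_inter_add_mset:
  assumes "u \<noteq> v"
  shows "add_mset u C \<inter># add_mset v C = C"
  using assms by (auto simp: multiset_eq_iff)

text \<open>Intersecting the two members of the image gives back \<open>C\<close>; once
  \<open>C\<close> is known, \<open>e\<close> follows because adding an element to a fixed multiset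
  is injective.\<close>

lemma inj_on_add_mset_image:
  assumes "\<And>e. e \<in> E \<Longrightarrow> card e = 2"
  shows "inj_on (\<lambda>(e, C). (\<lambda>x. add_mset x C) ` e) (E \<times> X)"
proof (rule inj_onI, clarify)
  fix e C e' C'
  assume e: "e \<in> E" "e' \<in> E" and eq: "(\<lambda>x. add_mset x C) ` e = (\<lambda>x. add_mset x C') ` e'"
  obtain u v where uv: "e = {u, v}" "u \<noteq> v"
    using assms[OF e(1)] by (auto simp: card_2_iff)
  obtain x y where xy: "e' = {x, y}" "x \<noteq> y"
    using assms[OF e(2)] by (auto simp: card_2_iff)
  have "{add_mset u C, add_mset v C} = {add_mset x C', add_mset y C'}"
    using eq uv(1) xy(1) by simp
  \<comment> \<open>The doubletons may match in either order; commutativity of the intersection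
    makes both cases agree.\<close>
  then have "add_mset u C \<inter># add_mset v C = add_mset x C' \<inter># add_mset y C'"
    unfolding doubleton_eq_iff by (elim disjE conjE) (simp_all only: subset_mset.inf_commute)
  then have "C = C'"
    using uv(2) xy(2) by (metis add_mset_inter_add_mset)
  moreover have "inj (\<lambda>x. add_mset x C)"
    by (simp add: inj_def)
  ultimately show "e = e' \<and> C = C'"
    using eq by (simp add: inj_image_eq_iff)
qed

text \<open>Writing an edge as the image of the whole set \<open>e\<close> avoids choosing a
  direction for the move: both directions along \<open>e\<close> give the same unordered
  pair.\<close>

lemma edges_supertoken_graph:
  assumes "simple_graph G" "k \<ge> 1"
  shows "edges (supertoken_graph k G) =
    (\<lambda>(e, C). (\<lambda>x. add_mset x C) ` e) ` (edges G \<times> multisets_of_size (verts G) (k - 1))"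
    (is "?L = ?R")
proof (intro equalityI subsetI)
  fix S assume "S \<in> ?L"
  then obtain A u v where A: "size A = k" "set_mset A \<subseteq> verts G" and uv: "{u, v} \<in> edges G"
    and u: "u \<in># A" and S: "S = {A, add_mset v (A - {#u#})}"
    by (auto simp: supertoken_graph_def Let_def token_move_def)
  \<comment> \<open>Lifting one copy of the moved token \<open>u\<close> off \<open>A\<close> leaves
    the \<open>k - 1\<close> stationary tokens.\<close>
  have "A - {#u#} \<in> multisets_of_size (verts G) (k - 1)"
    using A u by (auto simp: multisets_of_size_def size_Diff_singleton dest: in_diffD)
  moreover have "S = (\<lambda>x. add_mset x (A - {#u#})) ` {u, v}"
    using S u by simp
  ultimately show "S \<in> ?R"
    using uv by (intro image_eqI[where x = "({u, v}, A - {#u#})"]) auto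
next
  fix S assume "S \<in> ?R"
  then obtain e C where e: "e \<in> edges G" and C: "set_mset C \<subseteq> verts G" "size C = k - 1"
    and S: "S = (\<lambda>x. add_mset x C) ` e"
    by (auto simp: multisets_of_size_def)
  obtain u v where uv: "e = {u, v}" "u \<in> verts G" "v \<in> verts G"
    using assms(1) e unfolding simple_graph_def card_2_iff by (metis insert_subset)
  have "token_move G (add_mset u C) (add_mset v C)"
    unfolding token_move_def
    by (intro exI[where x = u] exI[where x = v]) (use e uv(1) in simp)
  moreover have "S = {add_mset u C, add_mset v C}"
    using S uv(1) by simp
  \<comment> \<open>Both endpoints have size \<open>(k - 1) + 1\<close>, which equals
    \<open>k\<close> only because \<open>k \<ge> 1\<close>.\<close>
  ultimately show "S \<in> ?L"
    unfolding supertoken_graph_def Let_def graph.simps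
    by (intro CollectI exI[where x = "add_mset u C"] exI[where x = "add_mset v C"])
      (use C uv(2,3) assms(2) in simp)
qed

theorem proposition5p1:
  fixes G :: "'a graph" and n m k :: nat
  assumes "simple_graph G"
    and "card (verts G) = n"
    and "card (edges G) = m"
    and "k \<ge> 1"
  shows "card (edges (supertoken_graph k G)) = m * ((n + k - 2) choose (k - 1))"
proof -
  have "card (edges (supertoken_graph k G)) =
      card (edges G \<times> multisets_of_size (verts G) (k - 1))"
    using assms(1) unfolding edges_supertoken_graph[OF assms(1,4)]
    by (intro card_image inj_on_add_mset_image) (simp add: simple_graph_def)
  \<comment> \<open>Stars and bars for multisets of size \<open>k - 1\<close> over \<open>n\<close>
    vertices.\<close>
  also have "\<dots> = m * ((n + (k - 1) - 1) choose (k - 1))"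
    using assms(1-3) by (simp add: card_cartesian_product card_multisets_of_size simple_graph_def)
  \<comment> \<open>Subtraction is truncated: at \<open>k = 0\<close> the two sides would be
    \<open>n - 1\<close> and \<open>n - 2\<close>.\<close>
  also have "n + (k - 1) - 1 = n + k - 2"
    using assms(4) by simp
  finally show ?thesis .
qed

end
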